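(* Let $T>0$, let $W$ be a separable Banach space and let $(S(t))_{t\ge 0}$ be an analytic $C_0$-semigroup on $W$ with $\|S(t)\|_{\mathcal L(W)}\le c_S$ for all $t\le T$. Let $0<\alpha\le 1$, $0\le \beta\le 1$, $\rho>1$ with $\alpha+\beta\le\rho$. Let $\Xi\in C(\Delta_T,W)$ satisfy, for all $0\le u\le m\le v\le T$, $$|\Xi_{vu}|\le c_1 (v-u)^{\alpha},$$ $$|(\hat\delta_2\Xi)_{vmu}|\le c_2\, u^{-\beta}(v-u)^{\rho}\quad\text{if } u\neq 0 .$$ Then there exists a unique $\mathcal I\Xi\in C([0,T],W)$ such that $$\mathcal I\Xi_0=0,$$ $$|(\hat\delta\,\mathcal I\Xi)_{ts}|\le C(c_1+c_2)(t-s)^{\alpha}\quad\text{for all }0\le s<t\le T,$$ $$|(\hat\delta\,\mathcal I\Xi)_{ts}-\Xi_{ts}|\le C c_2\, s^{-\beta}(t-s)^{\rho}\quad\text{for all }0<s<t\le T.$$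
   Context: Notation: $\Delta_T=\{(t,s): T\ge t>s\ge 0\}$, and two-parameter functions $\Xi$ on $\Delta_T$ are extended by $\Xi_{tt}=0$. $|\cdot|$ is the norm of $W$. For $y\in C([0,T],W)$, $(\hat\delta y)_{ts}:=y_t-S(t-s)y_s$. For $\Xi\in C(\Delta_T,W)$ and $s\le\tau\le t$, $(\hat\delta_2\Xi)_{t\tau s}:=\Xi_{ts}-\Xi_{t\tau}-S(t-\tau)\Xi_{\tau s}$. $C$ denotes a constant that may depend on the semigroup, $T$, $\alpha,\beta,\rho$, but not on $\Xi$, $c_1$, $c_2$, $s$, $t$. *)

theory Defs
  imports "HOL-Analysis.Analysis"
begin

definition C0_semigroup :: "(real \<Rightarrow> 'w::real_normed_vector \<Rightarrow>\<^sub>L 'w) \<Rightarrow> bool" where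
  "C0_semigroup S \<longleftrightarrow>
     S 0 = id_blinfun \<and>
     (\<forall>s\<ge>0. \<forall>t\<ge>0. S (s + t) = S s o\<^sub>L S t) \<and>
     (\<forall>x. ((\<lambda>t. S t x) \<longlongrightarrow> x) (at_right 0))"

text \<open>
  The type class \<open>banach\<close> is over the reals, so analyticity is expressed, as usual, through the
  complexification of the space: the pair \<open>(x, y)\<close> stands for \<open>x + i y\<close>. The product norm is
  in general not homogeneous for complex scalars, but it is equivalent to any of the usual
  complexification norms, and boundedness, limits and differentiability depend only on the topology.
  A complex Banach space is covered through its underlying real space: if \<open>S\<close> is complex linear,
  the complexified semigroup is the direct sum of \<open>S\<close> and its conjugate, so it has a holomorphic
  extension to a symmetric sector as soon as \<open>S\<close> has one.
\<close>

definition cscale :: "complex \<Rightarrow> 'w::real_vector \<times> 'w \<Rightarrow> 'w \<times> 'w" where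
  "cscale c v = (Re c *\<^sub>R fst v - Im c *\<^sub>R snd v, Im c *\<^sub>R fst v + Re c *\<^sub>R snd v)"

definition complex_linear_op ::
    "(('w::real_normed_vector \<times> 'w) \<Rightarrow>\<^sub>L ('w \<times> 'w)) \<Rightarrow> bool" where
  "complex_linear_op A \<longleftrightarrow> (\<forall>c v. A (cscale c v) = cscale c (A v))"

definition sector :: "real \<Rightarrow> complex set" where
  "sector \<theta> = {z. z \<noteq> 0 \<and> \<bar>Arg z\<bar> < \<theta>}"

text \<open>
  Holomorphy in operator norm: real Frechet differentiability with complex linear derivative.
\<close>

definition holomorphic_op_on ::
    "(complex \<Rightarrow> ('w::real_normed_vector \<times> 'w) \<Rightarrow>\<^sub>L ('w \<times> 'w)) \<Rightarrow> complex set \<Rightarrow> bool" where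
  "holomorphic_op_on F U \<longleftrightarrow>
     (\<forall>z\<in>U. \<exists>D. (F has_derivative D) (at z) \<and> (\<forall>c h v. D (c * h) v = cscale c (D h v)))"

definition analytic_C0_semigroup ::
    "(real \<Rightarrow> 'w::real_normed_vector \<Rightarrow>\<^sub>L 'w) \<Rightarrow> bool" where
  "analytic_C0_semigroup S \<longleftrightarrow>
     C0_semigroup S \<and>
     (\<exists>\<theta> F. 0 < \<theta> \<and> \<theta> \<le> pi / 2 \<and>
        (\<forall>z\<in>insert 0 (sector \<theta>). complex_linear_op (F z)) \<and>
        (\<forall>t\<ge>0. \<forall>x y. F (complex_of_real t) (x, y) = (S t x, S t y)) \<and>
        (\<forall>z\<in>insert 0 (sector \<theta>). \<forall>w\<in>insert 0 (sector \<theta>). F (z + w) = F z o\<^sub>L F w) \<and>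
        holomorphic_op_on F (sector \<theta>) \<and>
        (\<forall>\<theta>'. 0 < \<theta>' \<and> \<theta>' < \<theta> \<longrightarrow> (\<forall>v. ((\<lambda>z. F z v) \<longlongrightarrow> v) (at 0 within sector \<theta>'))))"

definition Delta :: "real \<Rightarrow> (real \<times> real) set" where
  "Delta T = {(t, s). 0 \<le> s \<and> s < t \<and> t \<le> T}"

definition hat_delta ::
    "(real \<Rightarrow> 'w::real_normed_vector \<Rightarrow>\<^sub>L 'w) \<Rightarrow> (real \<Rightarrow> 'w) \<Rightarrow> real \<Rightarrow> real \<Rightarrow> 'w" where
  "hat_delta S y t s = y t - S (t - s) (y s)"

definition hat_delta2 ::
    "(real \<Rightarrow> 'w::real_normed_vector \<Rightarrow>\<^sub>L 'w) \<Rightarrow> (real \<Rightarrow> real \<Rightarrow> 'w) \<Rightarrow>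
     real \<Rightarrow> real \<Rightarrow> real \<Rightarrow> 'w" where
  "hat_delta2 S \<Xi> t \<tau> s = \<Xi> t s - \<Xi> t \<tau> - S (t - \<tau>) (\<Xi> \<tau> s)"

text \<open>
  The conclusions of the sewing lemma for a candidate integral \<open>y\<close>, with constant \<open>C\<close>.
\<close>

definition sewing_integral ::
    "(real \<Rightarrow> 'w::real_normed_vector \<Rightarrow>\<^sub>L 'w) \<Rightarrow> real \<Rightarrow> real \<Rightarrow> real \<Rightarrow> real \<Rightarrow>
     (real \<Rightarrow> real \<Rightarrow> 'w) \<Rightarrow> real \<Rightarrow> real \<Rightarrow> real \<Rightarrow> (real \<Rightarrow> 'w) \<Rightarrow> bool" where
  "sewing_integral S T \<alpha> \<beta> \<rho> \<Xi> c1 c2 C y \<longleftrightarrow>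
     continuous_on {0..T} y \<and>
     y 0 = 0 \<and>
     (\<forall>s t. 0 \<le> s \<and> s < t \<and> t \<le> T \<longrightarrow>
        norm (hat_delta S y t s) \<le> C * (c1 + c2) * (t - s) powr \<alpha>) \<and>
     (\<forall>s t. 0 < s \<and> s < t \<and> t \<le> T \<longrightarrow>
        norm (hat_delta S y t s - \<Xi> t s) \<le> C * c2 * s powr (- \<beta>) * (t - s) powr \<rho>)"

end

theory Submission
  imports Defs
begin

text \<open>
  Away from 0 the germ has a regular defect, and the Riemann sums along the dyadic grid of
  \<open>[0, T]\<close>, clamped to \<open>[s, t]\<close>, converge to an additive \<open>K t s\<close>. Using one fixed grid for all
  intervals makes additivity immediate up to the single grid cell that contains the
  intermediate point, but it yields only \<open>K t s - \<Xi> t s = O((t - s) powr ((\<rho> + 1) / 2))\<close>. Since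
  this exponent exceeds 1, repeated bisection of \<open>[s, t]\<close> improves it to the sharp exponent
  \<open>\<rho>\<close>; bisection with zero defect also gives uniqueness. Near 0, decomposing \<open>[s, t]\<close>
  dyadically towards 0 and using \<open>\<alpha> + \<beta> \<le> \<rho>\<close> gives \<open>norm (K t s) = O((t - s) powr \<alpha>)\<close> uniformly in
  \<open>s > 0\<close>, so \<open>y t = lim K t r\<close> exists as \<open>r\<close> decreases to 0, and \<open>hat_delta S y t s = K t s\<close>.
\<close>

section \<open>Semigroups bounded on \<open>[0, T]\<close>, additivity and bisection\<close>

lemma hat_delta2_hat_delta:
  assumes "S (t - s) = S (t - m) o\<^sub>L S (m - s)"
  shows "hat_delta2 S (hat_delta S y) t m s = 0"
  by (simp add: hat_delta2_def hat_delta_def assms blinfun.diff_right)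

locale bounded_semigroup =
  fixes S :: "real \<Rightarrow> 'w::real_normed_vector \<Rightarrow>\<^sub>L 'w" and T M :: real
  assumes T_pos: "0 < T"
    and S_0: "S 0 = id_blinfun"
    and S_add: "\<And>s t. 0 \<le> s \<Longrightarrow> 0 \<le> t \<Longrightarrow> S (s + t) = S s o\<^sub>L S t"
    and S_bound: "\<And>t. 0 \<le> t \<Longrightarrow> t \<le> T \<Longrightarrow> norm (S t) \<le> M"
begin

lemma M_nonneg: "0 \<le> M"
  using S_bound[of 0] T_pos norm_ge_zero[of "S 0"] by linarith

lemma norm_S_le:
  assumes "0 \<le> t" "t \<le> T" "norm x \<le> b"
  shows "norm (S t x) \<le> M * b"
proof -
  have "norm (S t x) \<le> norm (S t) * norm x"
    by (rule norm_blinfun)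
  also have "\<dots> \<le> M * b"
    using assms S_bound M_nonneg by (intro mult_mono) auto
  finally show ?thesis .
qed

lemma S_apply_diff:
  assumes "s \<le> m" "m \<le> t"
  shows "S (t - s) x = S (t - m) (S (m - s) x)"
  using S_add[of "t - m" "m - s"] assms by simp

lemma hat_delta_additive:
  assumes "s \<le> m" "m \<le> t"
  shows "hat_delta2 S (hat_delta S y) t m s = 0"
  using S_add[of "t - m" "m - s"] assms by (intro hat_delta2_hat_delta) simp

text \<open>
  The orbit factor \<open>S \<tau>\<close> is carried through the bisection so that the bound \<open>M\<close>, which may
  exceed 1, enters only once instead of at every bisection step. The a priori bound with
  \<open>\<sigma> > 1\<close> is lost geometrically; its constant does not enter the conclusion.
\<close>

lemma bisection_estimate:
  assumes \<sigma>: "1 < \<sigma>" and \<rho>: "1 < \<rho>" and B: "0 \<le> B"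
    and apriori: "\<And>s t. s0 \<le> s \<Longrightarrow> s \<le> t \<Longrightarrow> t \<le> T \<Longrightarrow> norm (D t s) \<le> b * (t - s) powr \<sigma>"
    and defect: "\<And>s m t. s0 \<le> s \<Longrightarrow> s \<le> m \<Longrightarrow> m \<le> t \<Longrightarrow> t \<le> T \<Longrightarrow>
      norm (hat_delta2 S D t m s) \<le> B * (t - s) powr \<rho>"
    and s: "0 \<le> s0" "s0 \<le> s" and t: "s \<le> t" "t \<le> T"
  shows "norm (D t s) \<le> M * B / (1 - 2 powr (1 - \<rho>)) * (t - s) powr \<rho>"
proof -
  \<comment> \<open>One bisection turns a bound \<open>x\<close> into
    \<open>2 powr (1 - \<rho>) * x + M * B\<close>, since two halves contribute
    \<open>2 * (1 / 2) powr \<rho>\<close>; \<open>A\<close> is the fixed point of this map.\<close>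
  define A where "A = M * B / (1 - 2 powr (1 - \<rho>))"
  have "2 powr (1 - \<rho>) < 2 powr 0"
    using \<rho> by (intro powr_less_mono) auto
  then have "1 - 2 powr (1 - \<rho>) \<noteq> 0"
    using \<rho> by simp
  then have "(1 - 2 powr (1 - \<rho>)) * A = M * B"
    unfolding A_def by (metis nonzero_mult_div_cancel_left times_divide_eq_right)
  then have A: "2 powr (1 - \<rho>) * A + M * B = A"
    by (simp add: algebra_simps)
  have half: "2 * (x / 2) powr p = 2 powr (1 - p) * x powr p" if "0 \<le> x" for x p :: real
    using that by (simp add: powr_divide powr_diff)
  have bound: "norm (S \<tau> (D t s)) \<le> A * (t - s) powr \<rho> + M * b * (2 powr (1 - \<sigma>)) ^ n * (t - s) powr \<sigma>"
    if "s0 \<le> s" "s \<le> t" "0 \<le> \<tau>" "\<tau> + t \<le> T" for n s t \<tau>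
    using that
  proof (induction n arbitrary: s t \<tau>)
    case 0
    have "0 \<le> A"
      using \<open>2 powr (1 - \<rho>) < 2 powr 0\<close> M_nonneg B by (simp add: A_def)
    then have "0 \<le> A * (t - s) powr \<rho>" by simp
    moreover have "norm (S \<tau> (D t s)) \<le> M * (b * (t - s) powr \<sigma>)"
      using 0 s by (intro norm_S_le apriori) auto
    ultimately show ?case by simp
  next
    case (Suc n)
    define m where "m = (s + t) / 2"
    have m: "s \<le> m" "m \<le> t" "t - m = (t - s) / 2" "m - s = (t - s) / 2"
      using Suc.prems by (auto simp: m_def field_simps)
    let ?R = "\<lambda>x. A * x powr \<rho> + M * b * (2 powr (1 - \<sigma>)) ^ n * x powr \<sigma>"
    \<comment> \<open>The left half comes with the factor \<open>S (t - m)\<close>, which merges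
      into the orbit time. As \<open>\<tau> + (t - m) + m = \<tau> + t\<close>, the induction
      hypothesis still covers it.\<close>
    have "S (\<tau> + (t - m)) (D m s) = S \<tau> (S (t - m) (D m s))"
      using S_add[of \<tau> "t - m"] Suc.prems(3) m(2) by simp
    then have "S \<tau> (D t s) = S \<tau> (hat_delta2 S D t m s) + S \<tau> (D t m) + S (\<tau> + (t - m)) (D m s)"
      by (simp add: hat_delta2_def blinfun.diff_right)
    then have "norm (S \<tau> (D t s))
        \<le> norm (S \<tau> (hat_delta2 S D t m s)) + norm (S \<tau> (D t m)) + norm (S (\<tau> + (t - m)) (D m s))"
      by (metis norm_triangle_le norm_triangle_ineq add_right_mono)
    also have "\<dots> \<le> M * (B * (t - s) powr \<rho>) + ?R ((t - s) / 2) + ?R ((t - s) / 2)"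
    proof (intro add_mono)
      show "norm (S \<tau> (hat_delta2 S D t m s)) \<le> M * (B * (t - s) powr \<rho>)"
        using Suc.prems m s by (intro norm_S_le defect) auto
      show "norm (S \<tau> (D t m)) \<le> ?R ((t - s) / 2)"
        using Suc.IH[of m t \<tau>] Suc.prems m by simp
      show "norm (S (\<tau> + (t - m)) (D m s)) \<le> ?R ((t - s) / 2)"
        using Suc.IH[of s m "\<tau> + (t - m)"] Suc.prems m(1,2) unfolding m(4) by simp
    qed
    also have "\<dots> = M * B * (t - s) powr \<rho> + A * (2 * ((t - s) / 2) powr \<rho>)
        + M * b * (2 powr (1 - \<sigma>)) ^ n * (2 * ((t - s) / 2) powr \<sigma>)"
      by (simp add: algebra_simps)
    also have "\<dots> = (2 powr (1 - \<rho>) * A + M * B) * (t - s) powr \<rho>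
        + M * b * (2 powr (1 - \<sigma>)) ^ Suc n * (t - s) powr \<sigma>"
      using Suc.prems by (subst (1 2) half) (auto simp: algebra_simps)
    finally show ?case
      unfolding A .
  qed
  have "2 powr (1 - \<sigma>) < 2 powr 0"
    using \<sigma> by (intro powr_less_mono) auto
  then have "(\<lambda>n. A * (t - s) powr \<rho> + M * b * (2 powr (1 - \<sigma>)) ^ n * (t - s) powr \<sigma>)
      \<longlonglongrightarrow> A * (t - s) powr \<rho> + M * b * 0 * (t - s) powr \<sigma>"
    by (intro tendsto_intros LIMSEQ_power_zero) auto
  then have "norm (S 0 (D t s)) \<le> A * (t - s) powr \<rho> + M * b * 0 * (t - s) powr \<sigma>"
    using bound[of s t 0] s t by (intro LIMSEQ_le_const) auto
  then show ?thesis
    by (simp add: S_0 A_def)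
qed

text \<open>The defect of \<open>hat_delta S y\<close> vanishes, so bisection applies with
  \<open>B = 0\<close> and turns any bound of order above 1 into the bound 0.\<close>

lemma hat_delta_eq_0:
  assumes \<sigma>: "1 < \<sigma>"
    and "\<And>s t. s0 \<le> s \<Longrightarrow> s \<le> t \<Longrightarrow> t \<le> T \<Longrightarrow> norm (hat_delta S y t s) \<le> b * (t - s) powr \<sigma>"
    and "0 \<le> s0" "s0 \<le> s" "s \<le> t" "t \<le> T"
  shows "hat_delta S y t s = 0"
  using bisection_estimate[OF \<sigma> \<sigma> order_refl, of s0 "hat_delta S y" b s t] assms
  by (simp add: hat_delta_additive)

end

section \<open>Riemann sums along a fixed dyadic grid\<close>

text \<open>For \<open>s \<le> t\<close> this is the projection onto \<open>[s, t]\<close>. Grid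
  cells outside \<open>[s, t]\<close> collapse to a point, where the germ vanishes, so every sum may
  run over all cells of the grid.\<close>

definition clamp_to :: "real \<Rightarrow> real \<Rightarrow> real \<Rightarrow> real" where
  "clamp_to s t x = max s (min t x)"

lemma clamp_to_bounds: "s \<le> t \<Longrightarrow> s \<le> clamp_to s t x \<and> clamp_to s t x \<le> t"
  by (auto simp: clamp_to_def)

lemma clamp_to_mono: "x \<le> y \<Longrightarrow> clamp_to s t x \<le> clamp_to s t y"
  by (auto simp: clamp_to_def)

lemma clamp_to_diff_le: "x \<le> y \<Longrightarrow> clamp_to s t y - clamp_to s t x \<le> y - x"
  by (auto simp: clamp_to_def)

text \<open>The regular situation: the defect bound is uniform on \<open>[s0, T]\<close>. For a germ
  singular at 0 it is instantiated with \<open>s0 > 0\<close> and a factor \<open>B\<close>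
  depending on \<open>s0\<close>.\<close>

locale sewing_germ = bounded_semigroup S T M
  for S :: "real \<Rightarrow> 'w::banach \<Rightarrow>\<^sub>L 'w" and T M +
  fixes \<Xi> :: "real \<Rightarrow> real \<Rightarrow> 'w" and s0 B \<rho> :: real
  assumes s0: "0 \<le> s0"
    and \<rho>: "1 < \<rho>"
    and diag: "\<And>t. s0 \<le> t \<Longrightarrow> t \<le> T \<Longrightarrow> \<Xi> t t = 0"
    and defect: "\<And>u m v. s0 \<le> u \<Longrightarrow> u \<le> m \<Longrightarrow> m \<le> v \<Longrightarrow> v \<le> T \<Longrightarrow>
      norm (hat_delta2 S \<Xi> v m u) \<le> B * (v - u) powr \<rho>"

definition dyadic_grid :: "real \<Rightarrow> nat \<Rightarrow> nat \<Rightarrow> real" where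
  "dyadic_grid T n i = real i * T / 2 ^ n"

text \<open>A function with zero \<open>hat_delta2\<close> splits along any partition into terms of
  this form: \<open>S\<close> transports the increment over a cell from the right end of the cell to
  \<open>t\<close>.\<close>

definition riemann_sum ::
  "(real \<Rightarrow> 'w::real_normed_vector \<Rightarrow>\<^sub>L 'w) \<Rightarrow> real \<Rightarrow> (real \<Rightarrow> real \<Rightarrow> 'w) \<Rightarrow> nat \<Rightarrow> real \<Rightarrow> real \<Rightarrow> 'w"
  where
  "riemann_sum S T \<Xi> n t s =
     (let c = (\<lambda>i. clamp_to s t (dyadic_grid T n i))
      in \<Sum>i<2 ^ n. S (t - c (Suc i)) (\<Xi> (c (Suc i)) (c i)))"

text \<open>The left end \<open>s0\<close> does not enter, so instances of
  \<open>sewing_germ\<close> with different \<open>s0\<close> all speak about the same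
  function.\<close>

definition sewing ::
  "(real \<Rightarrow> 'w::real_normed_vector \<Rightarrow>\<^sub>L 'w) \<Rightarrow> real \<Rightarrow> (real \<Rightarrow> real \<Rightarrow> 'w) \<Rightarrow> real \<Rightarrow> real \<Rightarrow> 'w" where
  "sewing S T \<Xi> t s = lim (\<lambda>n. riemann_sum S T \<Xi> n t s)"

context sewing_germ
begin

lemma B_nonneg:
  assumes "s0 < T"
  shows "0 \<le> B"
proof -
  have "0 \<le> B * (T - s0) powr \<rho>"
    using defect[of s0 s0 T] assms by (intro order_trans[OF norm_ge_zero]) auto
  then show ?thesis
    using assms by (simp add: zero_le_mult_iff)
qed

lemma defect_left: "s0 \<le> u \<Longrightarrow> u \<le> T \<Longrightarrow> hat_delta2 S \<Xi> v u u = 0"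
  by (simp add: hat_delta2_def diag blinfun.zero_right)

lemma defect_right: "s0 \<le> v \<Longrightarrow> v \<le> T \<Longrightarrow> hat_delta2 S \<Xi> v v u = 0"
  by (simp add: hat_delta2_def diag S_0)

text \<open>With \<open>h = (\<rho> - 1) / 2\<close>, the power \<open>\<rho> = 1 + h + h\<close> of
  a cell length is split in three: the first factor sums to at most \<open>t - s\<close>, one power
  \<open>h\<close> is bounded by the mesh and gives geometric decay in \<open>n\<close>, the other
  is bounded by \<open>(t - s) powr h\<close> and keeps the exponent above 1. The points
  \<open>m i\<close> are free, which serves both refinement of the grid and insertion of an
  intermediate point.\<close>

lemma grid_defect_sum:
  fixes s t n
  defines "c \<equiv> \<lambda>i. clamp_to s t (dyadic_grid T n i)"
  assumes s: "s0 \<le> s" and t: "s \<le> t" "t \<le> T"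
    and m: "\<And>i. c i \<le> m i" "\<And>i. m i \<le> c (Suc i)"
  shows "norm (\<Sum>i<2 ^ n. S (t - c (Suc i)) (hat_delta2 S \<Xi> (c (Suc i)) (m i) (c i)))
    \<le> M * B * T powr ((\<rho> - 1) / 2) * (t - s) powr ((\<rho> + 1) / 2) * ((1 / 2) powr ((\<rho> - 1) / 2)) ^ n"
    (is "norm ?sum \<le> _")
proof (cases "s < t")
  \<comment> \<open>Both sides vanish here. The case is separated because \<open>B_nonneg\<close>
    requires \<open>s0 < T\<close>.\<close>
  case False
  then have "c i = s" for i
    using t by (auto simp: c_def clamp_to_def)
  moreover from this have "m i = s" for i
    using m by (metis order_antisym)
  ultimately have "?sum = 0"
    using s t False by (simp add: defect_left blinfun.zero_right)
  then show ?thesis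
    using False t by simp
next
  case True
  define h where "h = (\<rho> - 1) / 2"
  have h: "0 < h" "\<rho> = 1 + h + h" "(\<rho> + 1) / 2 = 1 + h"
    using \<rho> by (simp_all add: h_def field_simps)
  have B: "0 \<le> B"
    using True s t by (intro B_nonneg) auto
  have c: "s \<le> c i" "c i \<le> t" "c i \<le> c (Suc i)" "c (Suc i) - c i \<le> T * (1 / 2) ^ n" for i
  proof -
    show "s \<le> c i" "c i \<le> t"
      using clamp_to_bounds[OF t(1)] by (auto simp: c_def)
    have g: "dyadic_grid T n (Suc i) - dyadic_grid T n i = T * (1 / 2) ^ n"
      by (simp add: dyadic_grid_def field_simps power_divide)
    then have "dyadic_grid T n i \<le> dyadic_grid T n (Suc i)"
      using T_pos by (smt (verit) mult_nonneg_nonneg zero_le_power divide_nonneg_nonneg)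
    with g show "c i \<le> c (Suc i)" "c (Suc i) - c i \<le> T * (1 / 2) ^ n"
      unfolding c_def using clamp_to_diff_le clamp_to_mono by metis+
  qed
  have "(T * (1 / 2) ^ n) powr h = T powr h * ((1 / 2) powr h) ^ n"
    using T_pos by (simp add: powr_mult powr_power powr_powr flip: powr_realpow)
      (simp add: powr_powr mult.commute)
  note pow = this
  have "norm ?sum \<le> (\<Sum>i<2 ^ n. (c (Suc i) - c i) * (M * B * (T * (1 / 2) ^ n) powr h * (t - s) powr h))"
  proof (rule sum_norm_le)
    fix i
    let ?l = "c (Suc i) - c i"
    have l: "0 \<le> ?l" "?l \<le> t - s"
      using c[of i] c[of "Suc i"] by auto
    have "norm (S (t - c (Suc i)) (hat_delta2 S \<Xi> (c (Suc i)) (m i) (c i))) \<le> M * (B * ?l powr \<rho>)"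
      using c[of i] c[of "Suc i"] s t s0 m by (intro norm_S_le defect) (auto intro: order_trans)
    also have "?l powr \<rho> = ?l * ?l powr h * ?l powr h"
      unfolding h(2) powr_add using l(1) by simp
    also have "M * (B * \<dots>) \<le> M * (B * (?l * (T * (1 / 2) ^ n) powr h * (t - s) powr h))"
      using l c[of i] h(1) M_nonneg B by (intro mult_left_mono mult_mono powr_mono2) auto
    finally show "norm (S (t - c (Suc i)) (hat_delta2 S \<Xi> (c (Suc i)) (m i) (c i)))
        \<le> ?l * (M * B * (T * (1 / 2) ^ n) powr h * (t - s) powr h)"
      by (simp add: algebra_simps)
  qed
  also have "\<dots> = (c (2 ^ n) - c 0) * (M * B * (T * (1 / 2) ^ n) powr h * (t - s) powr h)"
    by (simp add: sum_lessThan_telescope flip: sum_distrib_right)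
  also have "\<dots> \<le> (t - s) * (M * B * (T * (1 / 2) ^ n) powr h * (t - s) powr h)"
    using c(1)[of 0] c(2)[of "2 ^ n"] M_nonneg B by (intro mult_right_mono) auto
  also have "\<dots> = M * B * T powr h * ((t - s) * (t - s) powr h) * ((1 / 2) powr h) ^ n"
    unfolding pow by (simp add: algebra_simps)
  also have "(t - s) * (t - s) powr h = (t - s) powr (1 + h)"
    using True by (simp add: powr_add)
  finally show ?thesis
    by (simp add: h(3) h_def)
qed

lemma riemann_sum_0:
  assumes "s0 \<le> s" "s \<le> t" "t \<le> T"
  shows "riemann_sum S T \<Xi> 0 t s = \<Xi> t s"
  using assms s0 by (simp add: riemann_sum_def dyadic_grid_def clamp_to_def S_0)

text \<open>Cell \<open>i\<close> of level \<open>n\<close> consists of the cells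
  \<open>2 * i\<close> and \<open>2 * i + 1\<close> of level \<open>Suc n\<close>, so refinement
  costs one transported defect per cell, taken at the clamped midpoint.\<close>

lemma riemann_sum_Suc:
  fixes s t n
  defines "c \<equiv> \<lambda>i. clamp_to s t (dyadic_grid T n i)"
    and "m \<equiv> \<lambda>i. clamp_to s t (dyadic_grid T (Suc n) (2 * i + 1))"
  assumes "s0 \<le> s" and st: "s \<le> t" and "t \<le> T"
  shows "riemann_sum S T \<Xi> n t s - riemann_sum S T \<Xi> (Suc n) t s =
    (\<Sum>i<2 ^ n. S (t - c (Suc i)) (hat_delta2 S \<Xi> (c (Suc i)) (m i) (c i)))"
    and "c i \<le> m i" "m i \<le> c (Suc i)"
proof -
  have cm: "c i \<le> m i" "m i \<le> c (Suc i)" for i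
    unfolding c_def m_def using T_pos
    by (auto intro!: clamp_to_mono simp: dyadic_grid_def field_simps)
  then show "c i \<le> m i" "m i \<le> c (Suc i)" by auto
  have g: "dyadic_grid T (Suc n) (2 * i) = dyadic_grid T n i"
    "dyadic_grid T (Suc n) (Suc (Suc (2 * i))) = dyadic_grid T n (Suc i)" for i
    by (simp_all add: dyadic_grid_def field_simps)
  define f where "f j = S (t - clamp_to s t (dyadic_grid T (Suc n) (Suc j)))
     (\<Xi> (clamp_to s t (dyadic_grid T (Suc n) (Suc j))) (clamp_to s t (dyadic_grid T (Suc n) j)))" for j
  have "riemann_sum S T \<Xi> (Suc n) t s = (\<Sum>j<2 ^ n * 2. f j)"
    by (simp add: riemann_sum_def f_def Let_def mult.commute)
  also have "\<dots> = (\<Sum>i<2 ^ n. f (2 * i) + f (Suc (2 * i)))"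
    by (subst sum.nat_group[symmetric]) (simp add: numeral_2_eq_2 mult.commute)
  also have "\<dots> = (\<Sum>i<2 ^ n. S (t - m i) (\<Xi> (m i) (c i)) + S (t - c (Suc i)) (\<Xi> (c (Suc i)) (m i)))"
    unfolding f_def g by (simp add: c_def m_def)
  finally have "riemann_sum S T \<Xi> n t s - riemann_sum S T \<Xi> (Suc n) t s =
      (\<Sum>i<2 ^ n. S (t - c (Suc i)) (\<Xi> (c (Suc i)) (c i))
        - (S (t - m i) (\<Xi> (m i) (c i)) + S (t - c (Suc i)) (\<Xi> (c (Suc i)) (m i))))"
    by (simp add: riemann_sum_def c_def Let_def sum_subtractf)
  also have "\<dots> = (\<Sum>i<2 ^ n. S (t - c (Suc i)) (hat_delta2 S \<Xi> (c (Suc i)) (m i) (c i)))"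
  proof (rule sum.cong[OF refl])
    fix i
    have "c (Suc i) \<le> t"
      using clamp_to_bounds[OF st] by (auto simp: c_def)
    then show "S (t - c (Suc i)) (\<Xi> (c (Suc i)) (c i))
        - (S (t - m i) (\<Xi> (m i) (c i)) + S (t - c (Suc i)) (\<Xi> (c (Suc i)) (m i)))
        = S (t - c (Suc i)) (hat_delta2 S \<Xi> (c (Suc i)) (m i) (c i))"
      using S_apply_diff[OF cm(2)[of i], of t "\<Xi> (m i) (c i)"]
      by (simp add: hat_delta2_def blinfun.diff_right)
  qed
  finally show "riemann_sum S T \<Xi> n t s - riemann_sum S T \<Xi> (Suc n) t s =
    (\<Sum>i<2 ^ n. S (t - c (Suc i)) (hat_delta2 S \<Xi> (c (Suc i)) (m i) (c i)))" .
qed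

definition rate :: real where "rate = (1 / 2) powr ((\<rho> - 1) / 2)"

lemma rate: "0 \<le> rate" "rate < 1"
proof -
  show "0 \<le> rate" by (simp add: rate_def)
  have "(1 / 2) powr ((\<rho> - 1) / 2) < (1::real) powr ((\<rho> - 1) / 2)"
    using \<rho> by (intro powr_less_mono2) auto
  then show "rate < 1" by (simp add: rate_def)
qed

text \<open>Consecutive differences are dominated by a geometric series with ratio
  \<open>rate\<close>. Its sum bounds the distance to level 0, where the Riemann sum is
  \<open>\<Xi> t s\<close>; this is the a priori bound for the later bisection.\<close>

lemma riemann_sum_limit:
  assumes "s0 \<le> s" "s \<le> t" "t \<le> T"
  shows "(\<lambda>n. riemann_sum S T \<Xi> n t s) \<longlonglongrightarrow> sewing S T \<Xi> t s"
    and "norm (sewing S T \<Xi> t s - \<Xi> t s)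
      \<le> M * B * T powr ((\<rho> - 1) / 2) / (1 - rate) * (t - s) powr ((\<rho> + 1) / 2)"
proof -
  define R where "R n = riemann_sum S T \<Xi> n t s" for n
  define K where "K = M * B * T powr ((\<rho> - 1) / 2) * (t - s) powr ((\<rho> + 1) / 2)"
  have step: "norm (R (Suc n) - R n) \<le> K * rate ^ n" for n
    unfolding R_def K_def rate_def
    by (subst norm_minus_commute, subst riemann_sum_Suc(1)[OF assms],
        rule grid_defect_sum[OF assms riemann_sum_Suc(2,3)[OF assms]])
  have sm: "summable (\<lambda>n. K * rate ^ n)"
    using rate by (intro summable_mult summable_geometric) auto
  then have sn: "summable (\<lambda>n. norm (R (Suc n) - R n))"
    using step by (intro summable_comparison_test'[OF sm, of 0]) simp
  then have "(\<lambda>n. \<Sum>i<n. R (Suc i) - R i) \<longlonglongrightarrow> (\<Sum>i. R (Suc i) - R i)"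
    by (rule summable_LIMSEQ[OF summable_norm_cancel])
  then have "(\<lambda>n. R n - R 0) \<longlonglongrightarrow> (\<Sum>i. R (Suc i) - R i)"
    by (simp add: sum_lessThan_telescope)
  from tendsto_add[OF this tendsto_const[of "R 0"]]
  have lim: "R \<longlonglongrightarrow> (\<Sum>i. R (Suc i) - R i) + R 0"
    by simp
  then have eq: "sewing S T \<Xi> t s = (\<Sum>i. R (Suc i) - R i) + R 0"
    unfolding sewing_def R_def[symmetric] by (rule limI)
  with lim show "(\<lambda>n. riemann_sum S T \<Xi> n t s) \<longlonglongrightarrow> sewing S T \<Xi> t s"
    unfolding R_def[symmetric] by simp
  have "sewing S T \<Xi> t s - \<Xi> t s = (\<Sum>i. R (Suc i) - R i)"
    using eq riemann_sum_0[OF assms] by (simp add: R_def)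
  also have "norm \<dots> \<le> (\<Sum>i. norm (R (Suc i) - R i))"
    by (rule summable_norm[OF sn])
  also have "\<dots> \<le> (\<Sum>i. K * rate ^ i)"
    by (rule suminf_le[OF step sn sm])
  also have "\<dots> = K / (1 - rate)"
    using rate by (subst suminf_mult) (auto simp: suminf_geometric intro: summable_geometric)
  finally show "norm (sewing S T \<Xi> t s - \<Xi> t s)
      \<le> M * B * T powr ((\<rho> - 1) / 2) / (1 - rate) * (t - s) powr ((\<rho> + 1) / 2)"
    by (simp add: K_def)
qed

text \<open>All three sums use the same grid and can be compared cell by cell. In a cell to the left
  or right of \<open>s\<close>, clamping \<open>s\<close> to the cell gives an endpoint, and the
  defect is 0; only a cell with \<open>s\<close> in its interior leaves a genuine defect. The sum
  over all cells is kept to match \<open>grid_defect_sum\<close>.\<close>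

lemma riemann_sum_defect:
  fixes r t s n
  defines "c \<equiv> \<lambda>i. clamp_to r t (dyadic_grid T n i)"
  assumes r: "s0 \<le> r" and s: "r \<le> s" "s \<le> t" and t: "t \<le> T"
  shows "hat_delta2 S (riemann_sum S T \<Xi> n) t s r =
    (\<Sum>i<2 ^ n. S (t - c (Suc i)) (hat_delta2 S \<Xi> (c (Suc i)) (clamp_to (c i) (c (Suc i)) s) (c i)))"
proof -
  have pq: "S (t - clamp_to r t q) (\<Xi> (clamp_to r t q) (clamp_to r t p))
      - S (t - clamp_to s t q) (\<Xi> (clamp_to s t q) (clamp_to s t p))
      - S (t - s) (S (s - clamp_to r s q) (\<Xi> (clamp_to r s q) (clamp_to r s p)))
    = S (t - clamp_to r t q) (hat_delta2 S \<Xi> (clamp_to r t q)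
        (clamp_to (clamp_to r t p) (clamp_to r t q) s) (clamp_to r t p))"
    if "p \<le> q" for p q
  proof -
    consider "q \<le> s" | "s \<le> p" | "p < s" "s < q" by linarith
    then show ?thesis
    proof cases
      case 1
      then have "clamp_to s t q = s" "clamp_to s t p = s" "clamp_to r s q = clamp_to r t q"
        "clamp_to r s p = clamp_to r t p" "clamp_to (clamp_to r t p) (clamp_to r t q) s = clamp_to r t q"
        using s that by (auto simp: clamp_to_def)
      moreover have "s0 \<le> clamp_to r t q" "clamp_to r t q \<le> T" "clamp_to r t q \<le> s"
        using r s t 1 by (auto simp: clamp_to_def)
      ultimately show ?thesis
        using r s t S_apply_diff[of "clamp_to r t q" s t]
        by (simp add: diag defect_right blinfun.zero_right)
    next
      case 2
      then have "clamp_to r s q = s" "clamp_to r s p = s" "clamp_to s t q = clamp_to r t q"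
        "clamp_to s t p = clamp_to r t p" "clamp_to (clamp_to r t p) (clamp_to r t q) s = clamp_to r t p"
        using s that by (auto simp: clamp_to_def)
      moreover have "s0 \<le> clamp_to r t p" "clamp_to r t p \<le> T"
        using r s t 2 by (auto simp: clamp_to_def)
      ultimately show ?thesis
        using r s t by (simp add: diag defect_left blinfun.zero_right)
    next
      case 3
      then have "clamp_to r s q = s" "clamp_to r s p = clamp_to r t p" "clamp_to s t q = clamp_to r t q"
        "clamp_to s t p = s" "clamp_to (clamp_to r t p) (clamp_to r t q) s = s"
        using s that by (auto simp: clamp_to_def)
      moreover have "s \<le> clamp_to r t q" "clamp_to r t q \<le> t"
        using s 3 by (auto simp: clamp_to_def)
      ultimately show ?thesis
        using S_apply_diff[of s "clamp_to r t q" t]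
        by (simp add: hat_delta2_def S_0 blinfun.diff_right)
    qed
  qed
  have "dyadic_grid T n i \<le> dyadic_grid T n (Suc i)" for i
    using T_pos by (simp add: dyadic_grid_def field_simps)
  then show ?thesis
    unfolding hat_delta2_def[of S "riemann_sum S T \<Xi> n"] riemann_sum_def Let_def c_def
      blinfun.sum_right sum_subtractf[symmetric]
    by (intro sum.cong pq) auto
qed

text \<open>By \<open>grid_defect_sum\<close>, with \<open>s\<close> clamped to each cell as
  intermediate point, the defect of the Riemann sums decays like \<open>rate ^ n\<close>, and it
  passes to the limit.\<close>

lemma sewing_additive:
  assumes r: "s0 \<le> r" and s: "r \<le> s" "s \<le> t" and t: "t \<le> T"
  shows "hat_delta2 S (sewing S T \<Xi>) t s r = 0"
proof -
  have "(\<lambda>n. hat_delta2 S (riemann_sum S T \<Xi> n) t s r) \<longlonglongrightarrow> hat_delta2 S (sewing S T \<Xi>) t s r"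
    unfolding hat_delta2_def using assms
    by (intro tendsto_intros riemann_sum_limit) auto
  moreover have "(\<lambda>n. hat_delta2 S (riemann_sum S T \<Xi> n) t s r) \<longlonglongrightarrow> 0"
  proof (rule Lim_null_comparison)
    have "norm (hat_delta2 S (riemann_sum S T \<Xi> n) t s r)
        \<le> M * B * T powr ((\<rho> - 1) / 2) * (t - r) powr ((\<rho> + 1) / 2) * rate ^ n" for n
      unfolding riemann_sum_defect[OF assms] rate_def using assms T_pos
      by (intro grid_defect_sum clamp_to_bounds[THEN conjunct1] clamp_to_bounds[THEN conjunct2] clamp_to_mono)
        (auto simp: dyadic_grid_def field_simps)
    then show "\<forall>\<^sub>F n in sequentially. norm (hat_delta2 S (riemann_sum S T \<Xi> n) t s r)
        \<le> M * B * T powr ((\<rho> - 1) / 2) * (t - r) powr ((\<rho> + 1) / 2) * rate ^ n"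
      by simp
    show "(\<lambda>n. M * B * T powr ((\<rho> - 1) / 2) * (t - r) powr ((\<rho> + 1) / 2) * rate ^ n) \<longlonglongrightarrow> 0"
      using rate by (intro tendsto_mult_right_zero LIMSEQ_power_zero) auto
  qed
  ultimately show ?thesis
    by (rule LIMSEQ_unique)
qed

text \<open>Since \<open>sewing S T \<Xi>\<close> is additive, its difference from
  \<open>\<Xi>\<close> has the defect of \<open>\<Xi>\<close> up to sign. Bisection then improves
  the exponent \<open>(\<rho> + 1) / 2\<close> to \<open>\<rho>\<close>.\<close>

lemma sewing_estimate:
  assumes "s0 \<le> s" "s < t" "t \<le> T"
  shows "norm (sewing S T \<Xi> t s - \<Xi> t s) \<le> M * B / (1 - 2 powr (1 - \<rho>)) * (t - s) powr \<rho>"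
proof (rule bisection_estimate[where D = "\<lambda>t s. sewing S T \<Xi> t s - \<Xi> t s" and \<sigma> = "(\<rho> + 1) / 2"
      and b = "M * B * T powr ((\<rho> - 1) / 2) / (1 - rate)" and ?s0.0 = s0])
  fix s m t
  assume *: "s0 \<le> s" "s \<le> m" "m \<le> t" "t \<le> T"
  have "hat_delta2 S (\<lambda>t s. sewing S T \<Xi> t s - \<Xi> t s) t m s
      = hat_delta2 S (sewing S T \<Xi>) t m s - hat_delta2 S \<Xi> t m s"
    by (simp add: hat_delta2_def blinfun.diff_right)
  then show "norm (hat_delta2 S (\<lambda>t s. sewing S T \<Xi> t s - \<Xi> t s) t m s) \<le> B * (t - s) powr \<rho>"
    using sewing_additive[OF *] defect[OF *] by simp
qed (use assms \<rho> s0 riemann_sum_limit(2) B_nonneg in auto)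

end

section \<open>Strong continuity, continuity of the integral and uniqueness\<close>

lemma powr_small:
  fixes L a e :: real
  assumes "0 < a" "0 < e"
  obtains h where "0 < h" "\<And>x. 0 \<le> x \<Longrightarrow> x \<le> h \<Longrightarrow> L * x powr a < e"
proof
  \<comment> \<open>This solves \<open>(\<bar>L\<bar> + 1) * h powr a = e\<close>. The summand 1
    covers \<open>L = 0\<close> and makes the inequality strict for \<open>x > 0\<close>.\<close>
  let ?h = "(e / (\<bar>L\<bar> + 1)) powr (1 / a)"
  show "0 < ?h"
    using assms by simp
  fix x :: real assume x: "0 \<le> x" "x \<le> ?h"
  have "x powr a \<le> ?h powr a"
    using x assms by (intro powr_mono2) auto
  also have "\<dots> = e / (\<bar>L\<bar> + 1)"
    using assms by (simp add: powr_powr)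
  finally have "(\<bar>L\<bar> + 1) * x powr a \<le> e"
    by (simp add: field_simps)
  show "L * x powr a < e"
  proof (cases "x = 0")
    case False
    then have "L * x powr a < (\<bar>L\<bar> + 1) * x powr a"
      using x by (intro mult_strict_right_mono) auto
    then show ?thesis
      using \<open>(\<bar>L\<bar> + 1) * x powr a \<le> e\<close> by simp
  qed (use assms in simp)
qed

locale bounded_C0_semigroup = bounded_semigroup S T M
  for S :: "real \<Rightarrow> 'w::real_normed_vector \<Rightarrow>\<^sub>L 'w" and T M +
  assumes strong: "\<And>x. ((\<lambda>t. S t x) \<longlongrightarrow> x) (at_right 0)"
begin

text \<open>For \<open>a \<le> b\<close>, factoring \<open>S a\<close> out of
  \<open>S b x - S a x\<close> reduces continuity from either side to right continuity at 0, by the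
  uniform bound \<open>M\<close>.\<close>

lemma continuous_on_orbit: "continuous_on {0..T} (\<lambda>t. S t x)"
proof (rule continuous_on_iff[THEN iffD2], intro ballI allI impI)
  fix t0 e :: real
  assume t0: "t0 \<in> {0..T}" and e: "0 < e"
  \<comment> \<open>Only \<open>0 \<le> M\<close> is known, hence the denominator
    \<open>M + 1\<close>.\<close>
  have "0 < e / (M + 1)"
    using e M_nonneg by simp
  with strong[of x] have "\<forall>\<^sub>F t in at_right 0. dist (S t x) x < e / (M + 1)"
    by (rule tendstoD)
  then obtain d where d: "0 < d" "\<And>t. 0 < t \<Longrightarrow> t < d \<Longrightarrow> norm (S t x - x) < e / (M + 1)"
    unfolding eventually_at_right_field by (auto simp: dist_norm)
  have close: "dist (S b x) (S a x) < e" if "0 \<le> a" "a \<le> b" "b \<le> T" "b - a < d" for a b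
  proof (cases "a = b")
    case False
    have "S b x - S a x = S a (S (b - a) x - x)"
      using S_add[of a "b - a"] that by (simp add: blinfun.diff_right)
    also have "norm \<dots> \<le> M * (e / (M + 1))"
      using that False d(2)[of "b - a"] by (intro norm_S_le) auto
    also have "\<dots> < e"
      using e M_nonneg by (simp add: field_simps)
    finally show ?thesis
      by (simp add: dist_norm)
  qed (use e in simp)
  have "dist (S t x) (S t0 x) < e" if "t \<in> {0..T}" "dist t t0 < d" for t
    using close[of t t0] close[of t0 t] t0 that
    by (cases "t \<le> t0") (auto simp: dist_commute dist_real_def)
  with d(1) show "\<exists>d>0. \<forall>t\<in>{0..T}. dist t t0 < d \<longrightarrow> dist (S t x) (S t0 x) < e"
    by blast
qed

text \<open>
  Comparing \<open>y t\<close> and \<open>y t0\<close> through a common earlier time \<open>r\<close>, instead of with each other,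
  avoids the joint continuity of \<open>(\<tau>, x) \<mapsto> S \<tau> x\<close> when \<open>t\<close> increases to \<open>t0\<close>.
\<close>

lemma continuous_on_hat_delta:
  assumes \<alpha>: "0 < \<alpha>"
    and bound: "\<And>s t. 0 \<le> s \<Longrightarrow> s < t \<Longrightarrow> t \<le> T \<Longrightarrow> norm (hat_delta S y t s) \<le> L * (t - s) powr \<alpha>"
  shows "continuous_on {0..T} y"
proof (rule continuous_on_iff[THEN iffD2], intro ballI allI impI)
  fix t0 e :: real
  assume t0: "t0 \<in> {0..T}" and e: "0 < e"
  obtain h where h: "0 < h" "\<And>x. 0 \<le> x \<Longrightarrow> x \<le> h \<Longrightarrow> L * x powr \<alpha> < e / 3"
    using powr_small[of \<alpha> "e / 3" L] \<alpha> e by auto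
  \<comment> \<open>With half of \<open>h\<close>, every \<open>t\<close> in \<open>[0, T]\<close>
    closer than \<open>h / 2\<close> to \<open>t0\<close> satisfies \<open>r \<le> t\<close> and
    \<open>t - r \<le> h\<close>.\<close>
  define r where "r = max 0 (t0 - h / 2)"
  have r: "0 \<le> r" "r \<le> t0"
    using t0 h by (auto simp: r_def)
  have hd: "norm (hat_delta S y t r) < e / 3" if "t \<in> {0..T}" "dist t t0 < h / 2" for t
  proof (cases "t = r")
    case False
    then have t: "r < t" "t \<le> T" "t - r \<le> h"
      using that False unfolding r_def dist_real_def atLeastAtMost_iff by linarith+
    show ?thesis
      using bound[OF r(1) t(1,2)] h(2)[of "t - r"] t by simp
  qed (use e in \<open>simp add: hat_delta_def S_0\<close>)
  have "t0 - r \<in> {0..T}"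
    using r t0 by auto
  then obtain d where d: "0 < d"
    "\<And>t. t \<in> {0..T} \<Longrightarrow> dist t (t0 - r) < d \<Longrightarrow> dist (S t (y r)) (S (t0 - r) (y r)) < e / 3"
    using continuous_on_orbit[of "y r"] e unfolding continuous_on_iff
    by (metis divide_pos_pos zero_less_numeral)
  show "\<exists>d>0. \<forall>t\<in>{0..T}. dist t t0 < d \<longrightarrow> dist (y t) (y t0) < e"
  proof (intro exI[of _ "min d (h / 2)"] conjI ballI impI)
    fix t assume t: "t \<in> {0..T}" "dist t t0 < min d (h / 2)"
    have "y t - y t0 = hat_delta S y t r + (- hat_delta S y t0 r + (S (t - r) (y r) - S (t0 - r) (y r)))"
      by (simp add: hat_delta_def)
    then have "norm (y t - y t0) \<le> norm (hat_delta S y t r) + (norm (hat_delta S y t0 r)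
        + norm (S (t - r) (y r) - S (t0 - r) (y r)))"
      by (metis norm_triangle_mono order_refl norm_triangle_ineq norm_minus_cancel)
    moreover have "norm (hat_delta S y t r) < e / 3"
      using t by (intro hd) auto
    moreover have "norm (hat_delta S y t0 r) < e / 3"
      using t0 h by (intro hd) auto
    moreover have "t - r \<in> {0..T}"
      using t r(1) unfolding r_def dist_real_def atLeastAtMost_iff by linarith
    then have "norm (S (t - r) (y r) - S (t0 - r) (y r)) < e / 3"
      using d(2)[of "t - r"] t by (simp add: dist_norm)
    ultimately show "dist (y t) (y t0) < e"
      by (simp add: dist_norm)
  qed (use d h in auto)
qed

text \<open>The germ cancels in the difference \<open>d\<close>, leaving a bound of order
  \<open>\<rho> > 1\<close> on \<open>[s, T]\<close> for each \<open>s > 0\<close>; so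
  \<open>d\<close> is an orbit there. The bound of order \<open>\<alpha>\<close> from time 0 makes
  \<open>d s\<close> vanish as \<open>s\<close> decreases to 0, and with it \<open>d t\<close>. The
  constants \<open>C\<close> and \<open>C'\<close> may differ.\<close>

lemma sewing_integral_unique:
  assumes \<alpha>: "0 < \<alpha>" and \<beta>: "0 \<le> \<beta>" and \<rho>: "1 < \<rho>"
    and y: "sewing_integral S T \<alpha> \<beta> \<rho> \<Xi> c1 c2 C y" and y': "sewing_integral S T \<alpha> \<beta> \<rho> \<Xi> c1 c2 C' y'"
    and t: "t \<in> {0..T}"
  shows "y' t = y t"
proof (cases "t = 0")
  case True
  then show ?thesis
    using y y' by (simp add: sewing_integral_def)
next
  case False
  define d where "d t = y t - y' t" for t
  have hd: "hat_delta S d t s = hat_delta S y t s - hat_delta S y' t s" for t s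
    by (simp add: hat_delta_def d_def blinfun.diff_right)
  let ?P = "C * (c1 + c2) + C' * (c1 + c2)"
  let ?Q = "C * c2 + C' * c2"
  have near0: "norm (hat_delta S d t s) \<le> ?P * (t - s) powr \<alpha>" if "0 \<le> s" "s < t" "t \<le> T" for s t
  proof -
    have "norm (hat_delta S d t s) \<le> norm (hat_delta S y t s) + norm (hat_delta S y' t s)"
      unfolding hd by (rule norm_triangle_ineq4)
    moreover have "norm (hat_delta S y t s) \<le> C * (c1 + c2) * (t - s) powr \<alpha>"
      and "norm (hat_delta S y' t s) \<le> C' * (c1 + c2) * (t - s) powr \<alpha>"
      using y y' that by (auto simp: sewing_integral_def)
    ultimately show ?thesis
      unfolding distrib_right[of "C * (c1 + c2)"] by linarith
  qed
  have germ: "norm (hat_delta S d t s) \<le> ?Q * s powr (- \<beta>) * (t - s) powr \<rho>"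
    if "0 < s" "s < t" "t \<le> T" for s t
  proof -
    have "norm (hat_delta S d t s) \<le> norm (hat_delta S y t s - \<Xi> t s) + norm (hat_delta S y' t s - \<Xi> t s)"
      using norm_triangle_ineq4[of "hat_delta S y t s - \<Xi> t s" "hat_delta S y' t s - \<Xi> t s"]
      by (simp add: hd)
    moreover have "norm (hat_delta S y t s - \<Xi> t s) \<le> C * c2 * s powr (- \<beta>) * (t - s) powr \<rho>"
      and "norm (hat_delta S y' t s - \<Xi> t s) \<le> C' * c2 * s powr (- \<beta>) * (t - s) powr \<rho>"
      using y y' that by (auto simp: sewing_integral_def)
    ultimately show ?thesis
      unfolding distrib_right[of "C * c2"] distrib_right[of "C * c2 * s powr (- \<beta>)"] by linarith
  qed
  \<comment> \<open>No sign of \<open>C\<close>, \<open>C'\<close> or \<open>c2\<close> is assumed;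
    the estimate itself forces this one.\<close>
  have Q: "0 \<le> ?Q"
  proof -
    have "0 \<le> (?Q * (T / 2) powr (- \<beta>)) * (T - T / 2) powr \<rho>"
      using germ[of "T / 2" T] T_pos by (intro order_trans[OF norm_ge_zero]) auto
    then show ?thesis
      using T_pos by (simp add: zero_le_mult_iff)
  qed
  have d_orbit: "d t = S (t - s) (d s)" if s: "0 < s" "s < t" for s
  proof -
    have "hat_delta S d t s = 0"
    proof (rule hat_delta_eq_0[OF \<rho>, of s d "?Q * s powr (- \<beta>)" s t])
      fix u v assume uv: "s \<le> u" "u \<le> v" "v \<le> T"
      show "norm (hat_delta S d v u) \<le> ?Q * s powr (- \<beta>) * (v - u) powr \<rho>"
      proof (cases "u = v")
        case False
        have "norm (hat_delta S d v u) \<le> ?Q * u powr (- \<beta>) * (v - u) powr \<rho>"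
          using uv s False by (intro germ) auto
        also have "\<dots> \<le> ?Q * s powr (- \<beta>) * (v - u) powr \<rho>"
          using uv s \<beta> Q by (intro mult_right_mono mult_left_mono powr_mono2') auto
        finally show ?thesis .
      qed (simp add: hat_delta_def S_0)
    qed (use s t in auto)
    then show ?thesis
      by (simp add: hat_delta_def)
  qed
  have "d 0 = 0"
    using y y' by (simp add: sewing_integral_def d_def)
  then have d_small: "norm (d s) \<le> ?P * s powr \<alpha>" if "0 < s" "s \<le> T" for s
    using near0[of 0 s] that by (simp add: hat_delta_def blinfun.zero_right)
  have "norm (d t) \<le> 0 + e" if e: "0 < e" for e
  proof -
    obtain h where h: "0 < h" "\<And>x. 0 \<le> x \<Longrightarrow> x \<le> h \<Longrightarrow> M * ?P * x powr \<alpha> < e"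
      using powr_small[OF \<alpha> e] by metis
    define s where "s = min h (t / 2)"
    have s: "0 < s" "s < t" "s \<le> h"
      using h t False by (auto simp: s_def)
    have "norm (d t) \<le> M * (?P * s powr \<alpha>)"
      unfolding d_orbit[OF s(1,2)] using s t by (intro norm_S_le d_small) auto
    also have "\<dots> < e"
      using h(2)[of s] s by (simp add: mult.assoc)
    finally show ?thesis by simp
  qed
  then have "norm (d t) \<le> 0"
    by (rule field_le_epsilon)
  then show ?thesis
    by (simp add: d_def)
qed

end

section \<open>Germs with a singularity at 0\<close>

definition germ_const :: "real \<Rightarrow> real \<Rightarrow> real" where
  "germ_const M \<rho> = M / (1 - 2 powr (1 - \<rho>))"

text \<open>For intervals no longer than their left endpoint: 1 accounts for the germ, the other
  summand for its distance to the sewn function.\<close>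

definition near_const :: "real \<Rightarrow> real \<Rightarrow> real \<Rightarrow> real \<Rightarrow> real \<Rightarrow> real" where
  "near_const M T \<alpha> \<beta> \<rho> = 1 + germ_const M \<rho> * T powr (\<rho> - \<beta> - \<alpha>)"

text \<open>The fixed point of \<open>x = M * near_const M T \<alpha> \<beta> \<rho> + 2 powr (-
  \<alpha>) * x\<close>, the recursion of dyadic splitting towards 0.\<close>

definition orbit_const :: "real \<Rightarrow> real \<Rightarrow> real \<Rightarrow> real \<Rightarrow> real \<Rightarrow> real" where
  "orbit_const M T \<alpha> \<beta> \<rho> = M * near_const M T \<alpha> \<beta> \<rho> / (1 - 2 powr (- \<alpha>))"

text \<open>A sum of nonnegative terms that dominates every bound required. It involves no data of
  the germ and can be chosen before \<open>\<Xi>\<close>, \<open>c1\<close> and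
  \<open>c2\<close>.\<close>

definition sewing_const :: "real \<Rightarrow> real \<Rightarrow> real \<Rightarrow> real \<Rightarrow> real \<Rightarrow> real" where
  "sewing_const M T \<alpha> \<beta> \<rho> =
     germ_const M \<rho> + near_const M T \<alpha> \<beta> \<rho> + 2 powr \<alpha> * orbit_const M T \<alpha> \<beta> \<rho>"

locale singular_germ = bounded_C0_semigroup S T M
  for S :: "real \<Rightarrow> 'w::banach \<Rightarrow>\<^sub>L 'w" and T M +
  fixes \<Xi> :: "real \<Rightarrow> real \<Rightarrow> 'w" and \<alpha> \<beta> \<rho> c1 c2 :: real
  assumes \<alpha>: "0 < \<alpha>" and \<beta>: "0 \<le> \<beta>" and \<rho>: "1 < \<rho>" "\<alpha> + \<beta> \<le> \<rho>"
    and diag: "\<And>t. 0 \<le> t \<Longrightarrow> t \<le> T \<Longrightarrow> \<Xi> t t = 0"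
    and size: "\<And>u v. 0 \<le> u \<Longrightarrow> u \<le> v \<Longrightarrow> v \<le> T \<Longrightarrow> norm (\<Xi> v u) \<le> c1 * (v - u) powr \<alpha>"
    and defect: "\<And>u m v. 0 < u \<Longrightarrow> u \<le> m \<Longrightarrow> m \<le> v \<Longrightarrow> v \<le> T \<Longrightarrow>
      norm (hat_delta2 S \<Xi> v m u) \<le> c2 * u powr (- \<beta>) * (v - u) powr \<rho>"
begin

lemma c1_nonneg: "0 \<le> c1"
proof -
  have "0 \<le> c1 * (T - 0) powr \<alpha>"
    using size[of 0 T] T_pos by (intro order_trans[OF norm_ge_zero]) auto
  then show ?thesis
    using T_pos by (simp add: zero_le_mult_iff)
qed

lemma c2_nonneg: "0 \<le> c2"
proof -
  have "0 \<le> (c2 * (T / 2) powr (- \<beta>)) * (T - T / 2) powr \<rho>"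
    using defect[of "T / 2" T T] T_pos by (intro order_trans[OF norm_ge_zero]) auto
  then show ?thesis
    using T_pos by (simp add: zero_le_mult_iff)
qed

lemma const_nonneg:
  "0 \<le> germ_const M \<rho>" "1 \<le> near_const M T \<alpha> \<beta> \<rho>" "0 \<le> orbit_const M T \<alpha> \<beta> \<rho>"
  and two_powr_less_1: "2 powr (- \<alpha>) < 1"
proof -
  have "2 powr (1 - \<rho>) < 2 powr 0"
    using \<rho> by (intro powr_less_mono) auto
  then show *: "0 \<le> germ_const M \<rho>"
    using M_nonneg by (simp add: germ_const_def)
  then show **: "1 \<le> near_const M T \<alpha> \<beta> \<rho>"
    by (simp add: near_const_def)
  have "2 powr (- \<alpha>) < 2 powr 0"
    using \<alpha> by (intro powr_less_mono) auto
  then show "2 powr (- \<alpha>) < 1"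
    by simp
  then show "0 \<le> orbit_const M T \<alpha> \<beta> \<rho>"
    using M_nonneg ** by (simp add: orbit_const_def)
qed

abbreviation K where "K \<equiv> sewing S T \<Xi>"

text \<open>On \<open>[s, T]\<close> the singular weight is at most
  \<open>s powr (- \<beta>)\<close>, so the regular theory applies with left end
  \<open>s\<close>.\<close>

lemma sewing_germ:
  assumes "0 < s"
  shows "sewing_germ S T M \<Xi> s (c2 * s powr (- \<beta>)) \<rho>"
proof (unfold_locales)
  fix u m v assume uv: "s \<le> u" "u \<le> m" "m \<le> v" "v \<le> T"
  have "norm (hat_delta2 S \<Xi> v m u) \<le> c2 * u powr (- \<beta>) * (v - u) powr \<rho>"
    using uv assms by (intro defect) auto
  also have "\<dots> \<le> c2 * s powr (- \<beta>) * (v - u) powr \<rho>"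
    using uv assms \<beta> c2_nonneg by (intro mult_right_mono mult_left_mono powr_mono2') auto
  finally show "norm (hat_delta2 S \<Xi> v m u) \<le> c2 * s powr (- \<beta>) * (v - u) powr \<rho>" .
qed (use assms \<rho> diag in auto)

lemma K_additive:
  assumes "0 < r" "r \<le> s" "s \<le> t" "t \<le> T"
  shows "K t r = K t s + S (t - s) (K s r)"
proof -
  interpret sewing_germ S T M \<Xi> r "c2 * r powr (- \<beta>)" \<rho>
    using assms by (intro sewing_germ)
  show ?thesis
    using sewing_additive[of r s t] assms by (simp add: hat_delta2_def algebra_simps)
qed

lemma K_diag: "0 < t \<Longrightarrow> t \<le> T \<Longrightarrow> K t t = 0"
  using K_additive[of t t t] by (simp add: S_0)

lemma K_estimate:
  assumes "0 < s" "s < t" "t \<le> T"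
  shows "norm (K t s - \<Xi> t s) \<le> germ_const M \<rho> * c2 * s powr (- \<beta>) * (t - s) powr \<rho>"
proof -
  interpret sewing_germ S T M \<Xi> s "c2 * s powr (- \<beta>)" \<rho>
    using assms by (intro sewing_germ)
  show ?thesis
    using sewing_estimate[of s t] assms by (simp add: germ_const_def mult.assoc)
qed

text \<open>The length \<open>l = t - s\<close> is at most \<open>s\<close>, so
  \<open>s powr (- \<beta>) * l powr \<rho>\<close> is at most
  \<open>l powr (\<rho> - \<beta>)\<close>. As \<open>\<alpha> + \<beta> \<le> \<rho>\<close>, the
  surplus over \<open>l powr \<alpha>\<close> is bounded by a power of \<open>T\<close>.\<close>

lemma norm_K_near:
  assumes s: "0 < s" "s < t" and t: "t \<le> T" "t \<le> 2 * s"
  shows "norm (K t s) \<le> near_const M T \<alpha> \<beta> \<rho> * (c1 + c2) * (t - s) powr \<alpha>"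
proof -
  define l where "l = t - s"
  have l: "0 < l" "l \<le> s" "l \<le> T"
    using s t by (auto simp: l_def)
  have "s powr (- \<beta>) * l powr \<rho> \<le> l powr (- \<beta>) * l powr \<rho>"
    using l \<beta> by (intro mult_right_mono powr_mono2') auto
  also have "\<dots> = l powr (\<rho> - \<beta> - \<alpha>) * l powr \<alpha>"
    by (simp flip: powr_add)
  also have "\<dots> \<le> T powr (\<rho> - \<beta> - \<alpha>) * l powr \<alpha>"
    using l \<rho> by (intro mult_right_mono powr_mono2) auto
  finally have p: "s powr (- \<beta>) * l powr \<rho> \<le> T powr (\<rho> - \<beta> - \<alpha>) * l powr \<alpha>" .
  have "norm (K t s) \<le> norm (\<Xi> t s) + norm (K t s - \<Xi> t s)"
    by (rule norm_triangle_sub)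
  also have "\<dots> \<le> c1 * l powr \<alpha> + germ_const M \<rho> * c2 * (s powr (- \<beta>) * l powr \<rho>)"
    using size[of s t] K_estimate[of s t] s t by (simp add: l_def mult.assoc)
  also have "\<dots> \<le> c1 * l powr \<alpha> + germ_const M \<rho> * c2 * (T powr (\<rho> - \<beta> - \<alpha>) * l powr \<alpha>)"
    using p const_nonneg c2_nonneg by (intro add_left_mono mult_left_mono) auto
  also have "\<dots> = (c1 + germ_const M \<rho> * T powr (\<rho> - \<beta> - \<alpha>) * c2) * l powr \<alpha>"
    by (simp add: algebra_simps)
  also have "\<dots> \<le> near_const M T \<alpha> \<beta> \<rho> * (c1 + c2) * l powr \<alpha>"
    using const_nonneg c1_nonneg c2_nonneg
    by (intro mult_right_mono) (auto simp: near_const_def algebra_simps)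
  finally show ?thesis
    by (simp add: l_def)
qed

text \<open>
  The singularity at 0 is absorbed by splitting \<open>[s, t]\<close> at \<open>t / 2, t / 4, \<dots>\<close>: on each piece
  the length is at most the left endpoint, and the contributions form a geometric series.
\<close>

lemma norm_S_K:
  assumes "0 < s" "s \<le> t" "0 \<le> \<tau>" "\<tau> + t \<le> T" "t \<le> 2 ^ n * s"
  shows "norm (S \<tau> (K t s)) \<le> orbit_const M T \<alpha> \<beta> \<rho> * (c1 + c2) * t powr \<alpha>"
  using assms
proof (induction n arbitrary: t \<tau>)
  case 0
  then have "K t s = 0"
    using K_diag[of t] by simp
  then show ?case
    using const_nonneg c1_nonneg c2_nonneg by (simp add: blinfun.zero_right)
next
  case (Suc n)
  let ?N = "near_const M T \<alpha> \<beta> \<rho>" and ?O = "orbit_const M T \<alpha> \<beta> \<rho>" and ?q = "2 powr (- \<alpha>)"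
  have "1 - ?q \<noteq> 0"
    using two_powr_less_1 by linarith
  then have "(1 - ?q) * ?O = M * ?N"
    unfolding orbit_const_def by (metis nonzero_mult_div_cancel_left times_divide_eq_right)
  then have O: "M * ?N + ?O * ?q = ?O"
    by (simp add: algebra_simps)
  have near: "norm (S \<tau> (K t u)) \<le> M * (?N * (c1 + c2) * t powr \<alpha>)"
    if u: "0 < u" "u \<le> t" "t \<le> 2 * u" for u
  proof (cases "u = t")
    case True
    then show ?thesis
      using Suc.prems M_nonneg const_nonneg c1_nonneg c2_nonneg by (simp add: K_diag blinfun.zero_right)
  next
    case False
    have "norm (K t u) \<le> ?N * (c1 + c2) * (t - u) powr \<alpha>"
      using u False Suc.prems by (intro norm_K_near) auto
    also have "\<dots> \<le> ?N * (c1 + c2) * t powr \<alpha>"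
      using u \<alpha> const_nonneg c1_nonneg c2_nonneg by (intro mult_left_mono powr_mono2) auto
    finally show ?thesis
      using Suc.prems by (intro norm_S_le) auto
  qed
  show ?case
  proof (cases "t \<le> 2 * s")
    case True
    then have "norm (S \<tau> (K t s)) \<le> M * ?N * (c1 + c2) * t powr \<alpha>"
      using near[of s] Suc.prems by (simp add: mult.assoc)
    also have "\<dots> \<le> ?O * (c1 + c2) * t powr \<alpha>"
    proof (intro mult_right_mono)
      have "0 \<le> ?O * ?q"
        using const_nonneg(3) by simp
      then show "M * ?N \<le> ?O"
        using O by linarith
    qed (use c1_nonneg c2_nonneg in auto)
    finally show ?thesis .
  next
    case False
    \<comment> \<open>The right half is as long as its left endpoint, so \<open>near\<close>
      applies. The left half falls under the induction hypothesis with orbit time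
      \<open>\<tau> + t / 2\<close>; it gains \<open>2 powr (- \<alpha>)\<close> because the bound
      is stated in powers of \<open>t\<close>, not of \<open>t - s\<close>.\<close>
    have "K t s = K t (t / 2) + S (t / 2) (K (t / 2) s)"
      using K_additive[of s "t / 2" t] Suc.prems False by simp
    moreover have "S (\<tau> + t / 2) (K (t / 2) s) = S \<tau> (S (t / 2) (K (t / 2) s))"
      using S_add[of \<tau> "t / 2"] Suc.prems by simp
    ultimately have "S \<tau> (K t s) = S \<tau> (K t (t / 2)) + S (\<tau> + t / 2) (K (t / 2) s)"
      by (simp add: blinfun.add_right)
    also have "norm \<dots> \<le> norm (S \<tau> (K t (t / 2))) + norm (S (\<tau> + t / 2) (K (t / 2) s))"
      by (rule norm_triangle_ineq)
    also have "\<dots> \<le> M * (?N * (c1 + c2) * t powr \<alpha>) + ?O * (c1 + c2) * (t / 2) powr \<alpha>"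
    proof (rule add_mono)
      show "norm (S \<tau> (K t (t / 2))) \<le> M * (?N * (c1 + c2) * t powr \<alpha>)"
        using Suc.prems by (intro near) auto
      show "norm (S (\<tau> + t / 2) (K (t / 2) s)) \<le> ?O * (c1 + c2) * (t / 2) powr \<alpha>"
        using Suc.prems False by (intro Suc.IH) auto
    qed
    also have "(t / 2) powr \<alpha> = ?q * t powr \<alpha>"
      using Suc.prems by (simp add: powr_divide powr_minus_divide)
    also have "M * (?N * (c1 + c2) * t powr \<alpha>) + ?O * (c1 + c2) * (?q * t powr \<alpha>)
        = (M * ?N + ?O * ?q) * (c1 + c2) * t powr \<alpha>"
      by (simp add: algebra_simps)
    finally show ?thesis
      unfolding O .
  qed
qed

text \<open>If \<open>t > 2 * s\<close>, then \<open>t \<le> 2 * (t - s)\<close>, and a bound by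
  \<open>t powr \<alpha>\<close> is as good as one by \<open>(t - s) powr \<alpha>\<close>;
  otherwise the interval is near.\<close>

lemma norm_K:
  assumes s: "0 < s" "s < t" and t: "t \<le> T"
  shows "norm (K t s) \<le> sewing_const M T \<alpha> \<beta> \<rho> * (c1 + c2) * (t - s) powr \<alpha>"
proof (cases "t \<le> 2 * s")
  case True
  have "norm (K t s) \<le> near_const M T \<alpha> \<beta> \<rho> * (c1 + c2) * (t - s) powr \<alpha>"
    using s t True by (intro norm_K_near) auto
  also have "\<dots> \<le> sewing_const M T \<alpha> \<beta> \<rho> * (c1 + c2) * (t - s) powr \<alpha>"
    using const_nonneg c1_nonneg c2_nonneg by (intro mult_right_mono) (auto simp: sewing_const_def)
  finally show ?thesis .
next
  case False
  obtain n where "t / s < 2 ^ n"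
    using real_arch_pow[of 2 "t / s"] by auto
  then have "norm (S 0 (K t s)) \<le> orbit_const M T \<alpha> \<beta> \<rho> * (c1 + c2) * t powr \<alpha>"
    using s t by (intro norm_S_K[of _ _ _ n]) (auto simp: field_simps)
  also have "\<dots> \<le> orbit_const M T \<alpha> \<beta> \<rho> * (c1 + c2) * (2 * (t - s)) powr \<alpha>"
    using False s \<alpha> const_nonneg c1_nonneg c2_nonneg by (intro mult_left_mono powr_mono2) auto
  also have "\<dots> = 2 powr \<alpha> * orbit_const M T \<alpha> \<beta> \<rho> * (c1 + c2) * (t - s) powr \<alpha>"
    using s by (subst powr_mult) (simp_all add: algebra_simps)
  also have "\<dots> \<le> sewing_const M T \<alpha> \<beta> \<rho> * (c1 + c2) * (t - s) powr \<alpha>"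
    using const_nonneg c1_nonneg c2_nonneg by (intro mult_right_mono) (auto simp: sewing_const_def)
  finally show ?thesis
    by (simp add: S_0)
qed

section \<open>The integral as a limit at 0\<close>

text \<open>The sequence tending to 0 is the same for all \<open>t\<close>, so limits at two times
  can be combined. Time 0 is treated apart because no term of the sequence lies to its left.\<close>

definition y :: "real \<Rightarrow> 'w" where
  "y t = (if t = 0 then 0 else lim (\<lambda>n. K t (T / real (Suc n))))"

text \<open>By additivity, moving the left end from \<open>r\<close> to a smaller \<open>r'\<close>
  changes \<open>K t r\<close> by \<open>S (t - r) (K r r')\<close>, which is of order
  \<open>r powr \<alpha>\<close>; this gives the Cauchy property.\<close>

lemma y_limit:
  assumes t: "0 < t" "t \<le> T"
  shows "(\<lambda>n. K t (T / real (Suc n))) \<longlonglongrightarrow> y t"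
proof -
  let ?r = "\<lambda>n. T / real (Suc n)" and ?L = "M * (sewing_const M T \<alpha> \<beta> \<rho> * (c1 + c2))"
  have "Cauchy (\<lambda>n. K t (?r n))"
  proof (rule metric_CauchyI)
    fix e :: real assume e: "0 < e"
    obtain h where h: "0 < h" "\<And>x. 0 \<le> x \<Longrightarrow> x \<le> h \<Longrightarrow> ?L * x powr \<alpha> < e"
      using powr_small[OF \<alpha> e] by metis
    have "\<forall>\<^sub>F n in sequentially. ?r n < min h t"
      using LIMSEQ_Suc[OF lim_const_over_n[of T]] h t by (intro order_tendstoD(2)) auto
    then obtain N where N: "\<And>n. N \<le> n \<Longrightarrow> ?r n < min h t"
      unfolding eventually_sequentially by blast
    have "dist (K t (?r m)) (K t (?r n)) < e" if mn: "N \<le> m" "N \<le> n" for m n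
      using mn
    proof (induction m n rule: linorder_wlog)
      case (le m n)
      show ?case
      proof (cases "m = n")
        case False
        have r: "0 < ?r n" "?r n < ?r m" "?r m < t" "?r m \<le> h"
          using le False T_pos N[of m] by (auto simp: divide_strict_left_mono)
        have "K t (?r n) - K t (?r m) = S (t - ?r m) (K (?r m) (?r n))"
          using K_additive[of "?r n" "?r m" t] r t by simp
        also have "norm \<dots> \<le> M * (sewing_const M T \<alpha> \<beta> \<rho> * (c1 + c2) * (?r m - ?r n) powr \<alpha>)"
          using r t by (intro norm_S_le norm_K) linarith+
        also have "\<dots> < e"
          using h(2)[of "?r m - ?r n"] r by (simp add: mult.assoc)
        finally show ?thesis
          by (simp add: dist_norm norm_minus_commute)
      qed (use e in simp)
    qed (simp add: dist_commute)
    then show "\<exists>N. \<forall>m\<ge>N. \<forall>n\<ge>N. dist (K t (?r m)) (K t (?r n)) < e"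
      by blast
  qed
  then show ?thesis
    using t by (auto simp: y_def convergent_LIMSEQ_iff dest: Cauchy_convergent)
qed

lemma eventually_grid_less: "0 < t \<Longrightarrow> \<forall>\<^sub>F n in sequentially. T / real (Suc n) < t"
  using LIMSEQ_Suc[OF lim_const_over_n[of T]] by (rule order_tendstoD(2))

text \<open>Once the left end has passed below \<open>s\<close>, additivity makes the approximating
  difference equal to \<open>K t s\<close>, so the sequence is eventually constant.\<close>

lemma hat_delta_y:
  assumes s: "0 < s" "s < t" and t: "t \<le> T"
  shows "hat_delta S y t s = K t s"
proof -
  have "(\<lambda>n. K t (T / real (Suc n)) - S (t - s) (K s (T / real (Suc n)))) \<longlonglongrightarrow> hat_delta S y t s"
    unfolding hat_delta_def using s t by (intro tendsto_intros y_limit) auto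
  moreover have "\<forall>\<^sub>F n in sequentially. K t (T / real (Suc n)) - S (t - s) (K s (T / real (Suc n))) = K t s"
  proof (rule eventually_mono[OF eventually_grid_less[OF s(1)]])
    fix n assume "T / real (Suc n) < s"
    then show "K t (T / real (Suc n)) - S (t - s) (K s (T / real (Suc n))) = K t s"
      using K_additive[of "T / real (Suc n)" s t] s t T_pos by simp
  qed
  ultimately show ?thesis
    by (rule LIMSEQ_unique[OF _ tendsto_eventually])
qed

lemma norm_hat_delta_y:
  assumes s: "0 \<le> s" "s < t" and t: "t \<le> T"
  shows "norm (hat_delta S y t s) \<le> sewing_const M T \<alpha> \<beta> \<rho> * (c1 + c2) * (t - s) powr \<alpha>"
proof (cases "s = 0")
  case False
  then show ?thesis
    using norm_K[of s t] hat_delta_y[of s t] assms by simp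
next
  case True
  have C: "0 \<le> sewing_const M T \<alpha> \<beta> \<rho> * (c1 + c2)"
    using const_nonneg c1_nonneg c2_nonneg by (simp add: sewing_const_def)
  have "\<forall>\<^sub>F n in sequentially. norm (K t (T / real (Suc n))) \<le> sewing_const M T \<alpha> \<beta> \<rho> * (c1 + c2) * t powr \<alpha>"
    using eventually_grid_less[of t]
  proof (rule eventually_mono)
    fix n assume n: "T / real (Suc n) < t"
    have "norm (K t (T / real (Suc n))) \<le> sewing_const M T \<alpha> \<beta> \<rho> * (c1 + c2) * (t - T / real (Suc n)) powr \<alpha>"
      using n t T_pos by (intro norm_K) auto
    also have "\<dots> \<le> sewing_const M T \<alpha> \<beta> \<rho> * (c1 + c2) * t powr \<alpha>"
      using n T_pos C \<alpha> by (intro mult_left_mono powr_mono2) auto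
    finally show "norm (K t (T / real (Suc n))) \<le> sewing_const M T \<alpha> \<beta> \<rho> * (c1 + c2) * t powr \<alpha>" .
  qed (use True s in simp)
  then have "norm (y t) \<le> sewing_const M T \<alpha> \<beta> \<rho> * (c1 + c2) * t powr \<alpha>"
    using s t True y_limit[of t] by (intro tendsto_upperbound[OF tendsto_norm]) auto
  then show ?thesis
    using True by (simp add: hat_delta_def y_def blinfun.zero_right)
qed

lemma sewing_integral_y: "sewing_integral S T \<alpha> \<beta> \<rho> \<Xi> c1 c2 (sewing_const M T \<alpha> \<beta> \<rho>) y"
  unfolding sewing_integral_def
proof (intro conjI allI impI)
  show "continuous_on {0..T} y"
    using \<alpha> norm_hat_delta_y by (rule continuous_on_hat_delta)
  show "y 0 = 0"
    by (simp add: y_def)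
next
  fix s t assume st: "0 < s \<and> s < t \<and> t \<le> T"
  have "norm (hat_delta S y t s - \<Xi> t s) \<le> germ_const M \<rho> * c2 * s powr (- \<beta>) * (t - s) powr \<rho>"
    using st K_estimate[of s t] by (simp add: hat_delta_y)
  also have "\<dots> \<le> sewing_const M T \<alpha> \<beta> \<rho> * c2 * s powr (- \<beta>) * (t - s) powr \<rho>"
    using const_nonneg c2_nonneg by (intro mult_right_mono) (auto simp: sewing_const_def)
  finally show "norm (hat_delta S y t s - \<Xi> t s)
      \<le> sewing_const M T \<alpha> \<beta> \<rho> * c2 * s powr (- \<beta>) * (t - s) powr \<rho>" .
qed (use norm_hat_delta_y in auto)

end

theorem theorem4p1:
  fixes S :: "real \<Rightarrow> 'w::banach \<Rightarrow>\<^sub>L 'w"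
    and T c\<^sub>S \<alpha> \<beta> \<rho> :: real
  assumes "0 < T"
    and "separable_space (euclidean :: 'w topology)"
    and "analytic_C0_semigroup S"
    and "\<And>t. 0 \<le> t \<Longrightarrow> t \<le> T \<Longrightarrow> norm (S t) \<le> c\<^sub>S"
    and "0 < \<alpha>" "\<alpha> \<le> 1"
    and "0 \<le> \<beta>" "\<beta> \<le> 1"
    and "1 < \<rho>" "\<alpha> + \<beta> \<le> \<rho>"
  shows "\<exists>C>0. \<forall>(\<Xi> :: real \<Rightarrow> real \<Rightarrow> 'w) c1 c2.
    continuous_on (Delta T) (\<lambda>(t, s). \<Xi> t s) \<longrightarrow>
    (\<forall>t\<in>{0..T}. \<Xi> t t = 0) \<longrightarrow>
    (\<forall>u m v. 0 \<le> u \<and> u \<le> m \<and> m \<le> v \<and> v \<le> T \<longrightarrow>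
       norm (\<Xi> v u) \<le> c1 * (v - u) powr \<alpha> \<and>
       (u \<noteq> 0 \<longrightarrow> norm (hat_delta2 S \<Xi> v m u) \<le> c2 * u powr (- \<beta>) * (v - u) powr \<rho>)) \<longrightarrow>
    (\<exists>y. sewing_integral S T \<alpha> \<beta> \<rho> \<Xi> c1 c2 C y \<and>
       (\<forall>C' y'. sewing_integral S T \<alpha> \<beta> \<rho> \<Xi> c1 c2 C' y' \<longrightarrow> (\<forall>t\<in>{0..T}. y' t = y t)))"
proof -
  have "C0_semigroup S"
    using assms(3) by (simp add: analytic_C0_semigroup_def)
  then interpret bounded_C0_semigroup S T c\<^sub>S
    using assms(1,4) by unfold_locales (auto simp: C0_semigroup_def)
  have germ: "singular_germ S T c\<^sub>S \<Xi> \<alpha> \<beta> \<rho> c1 c2"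
    if "\<forall>t\<in>{0..T}. \<Xi> t t = 0"
      and "\<forall>u m v. 0 \<le> u \<and> u \<le> m \<and> m \<le> v \<and> v \<le> T \<longrightarrow>
       norm (\<Xi> v u) \<le> c1 * (v - u) powr \<alpha> \<and>
       (u \<noteq> 0 \<longrightarrow> norm (hat_delta2 S \<Xi> v m u) \<le> c2 * u powr (- \<beta>) * (v - u) powr \<rho>)"
    for \<Xi> c1 c2
    using that assms(5-) by unfold_locales auto
  show ?thesis
  proof (intro exI[of _ "sewing_const c\<^sub>S T \<alpha> \<beta> \<rho>"] conjI allI impI)
    \<comment> \<open>Signs of the constants are proved inside the locale; the zero germ supplies an
      instance.\<close>
    interpret zero: singular_germ S T c\<^sub>S "\<lambda>_ _. 0" \<alpha> \<beta> \<rho> 0 0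
      by (rule germ) (auto simp: hat_delta2_def blinfun.zero_right)
    show "0 < sewing_const c\<^sub>S T \<alpha> \<beta> \<rho>"
      using zero.const_nonneg by (simp add: sewing_const_def add_nonneg_pos add_pos_nonneg)
  next
    fix \<Xi> :: "real \<Rightarrow> real \<Rightarrow> 'w" and c1 c2
    assume "\<forall>t\<in>{0..T}. \<Xi> t t = 0"
      and "\<forall>u m v. 0 \<le> u \<and> u \<le> m \<and> m \<le> v \<and> v \<le> T \<longrightarrow>
       norm (\<Xi> v u) \<le> c1 * (v - u) powr \<alpha> \<and>
       (u \<noteq> 0 \<longrightarrow> norm (hat_delta2 S \<Xi> v m u) \<le> c2 * u powr (- \<beta>) * (v - u) powr \<rho>)"
    then interpret singular_germ S T c\<^sub>S \<Xi> \<alpha> \<beta> \<rho> c1 c2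
      by (rule germ)
    show "\<exists>y. sewing_integral S T \<alpha> \<beta> \<rho> \<Xi> c1 c2 (sewing_const c\<^sub>S T \<alpha> \<beta> \<rho>) y \<and>
       (\<forall>C' y'. sewing_integral S T \<alpha> \<beta> \<rho> \<Xi> c1 c2 C' y' \<longrightarrow> (\<forall>t\<in>{0..T}. y' t = y t))"
      using sewing_integral_y sewing_integral_unique[OF \<alpha> \<beta> \<rho>(1)] by blast
  qed
qed

end
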